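(* Let $V$, $H$, $\widetilde{H}$ be complex Hilbert spaces, let $j \colon V \to H$ be a continuous linear map and $\tilde{j} \colon V \to \widetilde{H}$ a compact linear map. Let $\mathfrak{a}$ and, for all $n \in \mathbb{N}$, $\mathfrak{a}_n$ be continuous symmetric sesquilinear forms $V \times V \to \mathbb{C}$. Suppose that the sequence $(\mathfrak{a}_n)_{n \in \mathbb{N}}$ is uniformly $\tilde{j}$-elliptic and converges weakly to $\mathfrak{a}$. Moreover, suppose that $\lim_{n \to \infty} \dim (V(\mathfrak{a}_n) \cap \ker j) = \dim (V(\mathfrak{a}) \cap \ker j)$. Let $A_n$ be the graph associated with $(\mathfrak{a}_n,j)$. Then the graphs $A_n$ are bounded below uniformly in $n \in \mathbb{N}$.
   Context: Sesquilinear forms are linear in the first and antilinear in the second variable, and $\mathfrak{a}(u) := \mathfrak{a}(u,u)$. The sequence $(\mathfrak{a}_n)$ is uniformly $\tilde{j}$-elliptic if there exist $\mu,\omega > 0$ such that $\mathfrak{a}_n(u) + \omega \|\tilde{j}(u)\|_{\widetilde{H}}^2 \geq \mu \|u\|_V^2$ for all $n \in \mathbb{N}$ and $u \in V$. The sequence $(\mathfrak{a}_n)$ converges weakly to $\mathfrak{a}$ if $\lim_{n\to\infty} \mathfrak{a}_n(u_n,v) = \mathfrak{a}(u,v)$ for all $v \in V$ and all $u,u_1,u_2,\ldots \in V$ with $u_n \to u$ weakly in $V$. For a form $\mathfrak{b}$ on $V$, $V(\mathfrak{b}) := \{u \in V : \mathfrak{b}(u,v) = 0 \text{ for all } v \in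 \ker j\}$. If $V$, $H$, $\widetilde{H}$ are complex Hilbert spaces, $j \colon V \to H$ is continuous linear, $\tilde{j} \colon V \to \widetilde{H}$ is compact linear, and $\mathfrak{a}$, $\mathfrak{a}_n$ ($n \in \mathbb{N}$) are continuous symmetric sesquilinear forms on $V$ such that $(\mathfrak{a}_n)$ is uniformly $\tilde{j}$-elliptic and converges weakly to $\mathfrak{a}$, then the spaces $V(\mathfrak{a}) \cap \ker j$ and $V(\mathfrak{a}_n) \cap \ker j$ are finite dimensional. The graph associated with a form $\mathfrak{b}$ on $V$ and $j$ is the linear subspace $$\{(x,y) \in H \times H : \text{there exists } u \in V \text{ such that } j(u) = x \text{ and } \mathfrak{b}(u,v) = (y,j(v))_H \text{ for all } v \in V\}$$ of $H \times H$. Graphs $A_n$ are bounded below uniformly in $n$ if there exists $\omega \in \mathbb{R}$ such that $(x,y)_H + \omega \|x\|_H^2 \geq 0$ for all $n \in \mathbb{N}$ and all $(x,y) \in A_n$ (here $(x,y)_H \in \mathbb{R}$ for $(x,y) \in A_n$, since the $A_n$ are self-adjoint graphs). *)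

theory Defs
  imports "HOL-Analysis.Analysis"
begin

class complex_vector = real_vector +
  fixes scaleC :: "complex \<Rightarrow> 'a \<Rightarrow> 'a"  (infixr "*\<^sub>C" 75)
  assumes scaleC_add_right: "c *\<^sub>C (x + y) = c *\<^sub>C x + c *\<^sub>C y"
    and scaleC_add_left: "(c + d) *\<^sub>C x = c *\<^sub>C x + d *\<^sub>C x"
    and scaleC_scaleC: "c *\<^sub>C d *\<^sub>C x = (c * d) *\<^sub>C x"
    and scaleC_one: "1 *\<^sub>C x = x"
    and scaleR_scaleC: "r *\<^sub>R x = complex_of_real r *\<^sub>C x"

interpretation complex_vector: vector_space "scaleC :: complex \<Rightarrow> 'a \<Rightarrow> 'a::complex_vector"
  by unfold_locales (simp_all add: scaleC_add_right scaleC_add_left scaleC_scaleC scaleC_one)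

text \<open>Complex inner products are linear in the first and antilinear in the second argument.
  The class extends \<open>real_inner\<close> by requiring the real inner product to be the real part of the
  complex one. Positive definiteness and the usual norm, topology and metric are therefore
  inherited, since \<open>cinner x x\<close> is real by conjugate symmetry.\<close>

class complex_inner = complex_vector + real_inner +
  fixes cinner :: "'a \<Rightarrow> 'a \<Rightarrow> complex"
  assumes cinner_commute: "cinner x y = cnj (cinner y x)"
    and cinner_add_left: "cinner (x + y) z = cinner x z + cinner y z"
    and cinner_scaleC_left: "cinner (c *\<^sub>C x) y = c * cinner x y"
    and inner_eq_Re_cinner: "inner x y = Re (cinner x y)"

class complex_hilbert = complex_inner + complete_space

lemma cinner_self: "cinner x x = complex_of_real ((norm x)\<^sup>2)"
  for x :: "'a::complex_inner"
proof -
  have "Im (cinner x x) = 0"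
    by (metis add.inverse_neutral cinner_commute cnj.simps(2) equal_neg_zero)
  then show ?thesis
    by (simp add: complex_eq_iff power2_norm_eq_inner inner_eq_Re_cinner)
qed

instantiation complex :: complex_hilbert
begin

definition scaleC_complex :: "complex \<Rightarrow> complex \<Rightarrow> complex"
  where "scaleC_complex c x = c * x"

definition cinner_complex :: "complex \<Rightarrow> complex \<Rightarrow> complex"
  where "cinner_complex x y = x * cnj y"

instance
  by standard
    (auto simp: scaleC_complex_def cinner_complex_def inner_complex_def algebra_simps scaleR_conv_of_real)

end

abbreviation clinear :: "('a::complex_vector \<Rightarrow> 'b::complex_vector) \<Rightarrow> bool"
  where "clinear \<equiv> Vector_Spaces.linear scaleC scaleC"

abbreviation cdim :: "'a::complex_vector set \<Rightarrow> nat"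
  where "cdim \<equiv> complex_vector.dim"

definition null_space_of :: "('a \<Rightarrow> 'b::zero) \<Rightarrow> 'a set"
  where "null_space_of f = {u. f u = 0}"

definition continuous_linear_map :: "('a::complex_inner \<Rightarrow> 'b::complex_inner) \<Rightarrow> bool"
  where "continuous_linear_map f \<longleftrightarrow> clinear f \<and> continuous_on UNIV f"

definition compact_linear_map :: "('a::complex_inner \<Rightarrow> 'b::complex_inner) \<Rightarrow> bool"
  where "compact_linear_map f \<longleftrightarrow>
    clinear f \<and> (\<forall>B. bounded B \<longrightarrow> compact (closure (f ` B)))"

definition sesquilinear_form :: "('a::complex_vector \<Rightarrow> 'a \<Rightarrow> complex) \<Rightarrow> bool"
  where "sesquilinear_form a \<longleftrightarrow>
    (\<forall>u u' v. a (u + u') v = a u v + a u' v) \<and>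
    (\<forall>c u v. a (c *\<^sub>C u) v = c * a u v) \<and>
    (\<forall>u v v'. a u (v + v') = a u v + a u v') \<and>
    (\<forall>c u v. a u (c *\<^sub>C v) = cnj c * a u v)"

definition symmetric_form :: "('a \<Rightarrow> 'a \<Rightarrow> complex) \<Rightarrow> bool"
  where "symmetric_form a \<longleftrightarrow> (\<forall>u v. a u v = cnj (a v u))"

definition continuous_form :: "('a::topological_space \<Rightarrow> 'a \<Rightarrow> complex) \<Rightarrow> bool"
  where "continuous_form a \<longleftrightarrow> continuous_on UNIV (\<lambda>(u, v). a u v)"

text \<open>For symmetric forms the values \<open>a n u u\<close> are real, so taking real parts loses nothing.\<close>

definition uniformly_elliptic ::
    "('v::complex_inner \<Rightarrow> 'k::complex_inner) \<Rightarrow> (nat \<Rightarrow> 'v \<Rightarrow> 'v \<Rightarrow> complex) \<Rightarrow> bool"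
  where "uniformly_elliptic jt a \<longleftrightarrow>
    (\<exists>\<mu>>0. \<exists>\<omega>>0. \<forall>n u. Re (a n u u) + \<omega> * (norm (jt u))\<^sup>2 \<ge> \<mu> * (norm u)\<^sup>2)"

definition weakly_convergent_to :: "(nat \<Rightarrow> 'v::complex_inner) \<Rightarrow> 'v \<Rightarrow> bool"
  where "weakly_convergent_to us u \<longleftrightarrow> (\<forall>v. (\<lambda>n. cinner (us n) v) \<longlonglongrightarrow> cinner u v)"

definition forms_converge_weakly ::
    "(nat \<Rightarrow> 'v::complex_inner \<Rightarrow> 'v \<Rightarrow> complex) \<Rightarrow> ('v \<Rightarrow> 'v \<Rightarrow> complex) \<Rightarrow> bool"
  where "forms_converge_weakly an a \<longleftrightarrow>
    (\<forall>v u us. weakly_convergent_to us u \<longrightarrow> (\<lambda>n. an n (us n) v) \<longlonglongrightarrow> a u v)"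

text \<open>The space written \<open>V(b)\<close>; it depends on \<open>j\<close> through its kernel.\<close>

definition form_space :: "('v \<Rightarrow> 'h::zero) \<Rightarrow> ('v \<Rightarrow> 'v \<Rightarrow> complex) \<Rightarrow> 'v set"
  where "form_space j b = {u. \<forall>v\<in>null_space_of j. b u v = 0}"

definition associated_graph ::
    "('v \<Rightarrow> 'v \<Rightarrow> complex) \<Rightarrow> ('v \<Rightarrow> 'h::complex_inner) \<Rightarrow> ('h \<times> 'h) set"
  where "associated_graph b j = {(x, y). \<exists>u. j u = x \<and> (\<forall>v. b u v = cinner y (j v))}"

text \<open>The inequality is between complex numbers, hence includes that \<open>cinner x y\<close> is real.\<close>

definition uniformly_bounded_below :: "(nat \<Rightarrow> ('h::complex_inner \<times> 'h) set) \<Rightarrow> bool"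
  where "uniformly_bounded_below A \<longleftrightarrow>
    (\<exists>\<omega>::real. \<forall>n. \<forall>(x, y)\<in>A n. cinner x y \<in> \<real> \<and> Re (cinner x y) + \<omega> * (norm x)\<^sup>2 \<ge> 0)"

end

theory Submission
  imports Defs
begin

text \<open>
  If \<open>(x, y)\<close> lies in the graph of \<open>(b, j)\<close> with witness \<open>u\<close>, then \<open>u \<in> V(b)\<close> and
  \<open>(x, y) = b(u)\<close>. So one \<open>k\<close> is wanted with \<open>b(u) + k \<parallel>j u\<parallel>\<^sup>2 \<ge> 0\<close> for all forms \<open>b\<close> of the
  sequence and all \<open>u \<in> V(b)\<close>.

  The heart is \<open>converging_forms_bounded_below\<close>: when forms \<open>b\<^sub>k\<close> converge weakly to \<open>b\<close> and the
  dimensions of \<open>K\<^sub>k = V(b\<^sub>k) \<inter> ker j\<close> converge to that of \<open>K = V(b) \<inter> ker j\<close>, the bound cannot fail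
  for every \<open>k\<close> with the form \<open>b\<^sub>k\<close> and the constant \<open>k\<close>. On \<open>K\<^sub>k\<close> the form \<open>b\<^sub>k\<close> vanishes, so
  ellipticity makes the seminorm \<open>\<parallel>T u\<parallel>\<close>, with \<open>T\<close> the compact map, equivalent to the norm there.
  Compactness then makes \<open>K\<^sub>k\<close> finite dimensional, and it has a basis whose image under \<open>T\<close> is
  orthonormal. Suppose \<open>u \<in> V(b\<^sub>k)\<close> has \<open>b\<^sub>k(u) + k \<parallel>j u\<parallel>\<^sup>2 < 0\<close>. Subtracting an element of \<open>K\<^sub>k\<close>
  changes neither term, so \<open>T u\<close> may be taken orthogonal to \<open>T K\<^sub>k\<close> and of norm 1. The basis and
  \<open>u\<close> together are \<open>dim K\<^sub>k + 1\<close> vectors with orthonormal images, bounded in \<open>V\<close> by ellipticity, and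
  \<open>\<parallel>j u\<parallel>\<^sup>2\<close> is at most a constant over \<open>k\<close>. Along a subsequence all of them converge weakly and
  their images under \<open>T\<close> converge in norm. The limits lie in \<open>K\<close> and still have orthonormal images,
  so \<open>dim K \<ge> dim K\<^sub>k + 1\<close> for large \<open>k\<close>, against the convergence of dimensions.

  Applied to a constant sequence, this bounds each single form below; applied to a subsequence on
  which ever larger constants fail, it gives one constant for all but finitely many forms.
\<close>

section \<open>Complex inner products\<close>

text \<open>The topology is that of the real inner product, so limits of complex inner products are
  obtained from limits of real ones through this decomposition.\<close>

lemma cinner_eq_Complex: "cinner x y = Complex (inner x y) (inner x (\<i> *\<^sub>C y))"
  for x y :: "'a::complex_inner"
proof -
  have "cinner x (\<i> *\<^sub>C y) = cnj (\<i> * cinner y x)"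
    by (metis cinner_commute cinner_scaleC_left)
  also have "\<dots> = - \<i> * cinner x y"
    by (metis cinner_commute complex_cnj_mult complex_cnj_i)
  finally show ?thesis
    by (simp add: inner_eq_Re_cinner complex_eq_iff)
qed

lemma cinner_scaleC_right: "cinner x (c *\<^sub>C y) = cnj c * cinner x y"
  for x y :: "'a::complex_inner"
  by (metis cinner_commute cinner_scaleC_left complex_cnj_mult)

lemma cinner_zero_left [simp]: "cinner 0 y = 0" for y :: "'a::complex_inner"
  by (metis add_cancel_right_right cinner_add_left)

lemma cinner_zero_right [simp]: "cinner x 0 = 0" for x :: "'a::complex_inner"
  by (metis cinner_commute cinner_zero_left complex_cnj_zero)

lemma cinner_diff_left: "cinner (x - y) z = cinner x z - cinner y z"
  for x y z :: "'a::complex_inner"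
  by (metis add_diff_cancel_right' cinner_add_left diff_add_cancel)

lemma cinner_sum_left: "cinner (sum f A) z = (\<Sum>i\<in>A. cinner (f i) z)"
  for z :: "'a::complex_inner"
  by (induction A rule: infinite_finite_induct) (simp_all add: cinner_add_left)

lemma norm_scaleC: "norm (c *\<^sub>C x) = cmod c * norm x" for x :: "'a::complex_inner"
proof -
  have "complex_of_real ((norm (c *\<^sub>C x))\<^sup>2) = c * cnj c * complex_of_real ((norm x)\<^sup>2)"
    by (simp only: cinner_self[symmetric] cinner_scaleC_left cinner_scaleC_right mult_ac)
  also have "\<dots> = complex_of_real ((cmod c * norm x)\<^sup>2)"
    by (simp add: complex_norm_square[symmetric] power_mult_distrib del: of_real_power)
  finally have "(norm (c *\<^sub>C x))\<^sup>2 = (cmod c * norm x)\<^sup>2"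
    by (simp only: of_real_eq_iff)
  then show ?thesis
    by (simp add: power2_eq_iff_nonneg)
qed

lemma bounded_linear_scaleC: "bounded_linear (\<lambda>x :: 'a::complex_inner. c *\<^sub>C x)"
  by (rule bounded_linear_intro[where K = "cmod c"])
    (simp_all add: scaleC_add_right scaleR_scaleC scaleC_scaleC norm_scaleC mult.commute)

lemma tendsto_cinner:
  fixes f g :: "'i \<Rightarrow> 'a::complex_inner"
  assumes "(f \<longlongrightarrow> x) F" "(g \<longlongrightarrow> y) F"
  shows "((\<lambda>i. cinner (f i) (g i)) \<longlongrightarrow> cinner x y) F"
  unfolding cinner_eq_Complex
  by (intro tendsto_Complex tendsto_inner assms bounded_linear.tendsto[OF bounded_linear_scaleC])

lemma weakly_convergent_to_iff_inner:
  "weakly_convergent_to us u \<longleftrightarrow> (\<forall>v. (\<lambda>n. inner (us n) v) \<longlonglongrightarrow> inner u v)"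
proof
  assume "weakly_convergent_to us u"
  then show "\<forall>v. (\<lambda>n. inner (us n) v) \<longlonglongrightarrow> inner u v"
    by (auto simp: weakly_convergent_to_def inner_eq_Re_cinner intro: tendsto_Re)
next
  assume "\<forall>v. (\<lambda>n. inner (us n) v) \<longlonglongrightarrow> inner u v"
  then show "weakly_convergent_to us u"
    by (auto simp: weakly_convergent_to_def cinner_eq_Complex intro: tendsto_Complex)
qed

section \<open>Weak compactness of bounded sequences\<close>

text \<open>The representing vector minimises \<open>\<parallel>x\<parallel>\<^sup>2 - 2 f x\<close> over the subspace: minimising sequences are
  Cauchy by the parallelogram identity. For \<open>W = UNIV\<close> this is the Riesz representation theorem; for
  \<open>f = (\<lambda>x. inner x v)\<close> it gives the orthogonal projection of \<open>v\<close> to \<open>W\<close>.\<close>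

lemma riesz_on_closed_subspace:
  fixes f :: "'a::{real_inner,complete_space} \<Rightarrow> real"
  assumes f: "bounded_linear f" and W: "closed W" "subspace W"
  obtains p where "p \<in> W" "\<And>x. x \<in> W \<Longrightarrow> f x = inner x p"
proof -
  interpret f: bounded_linear f by (rule f)
  define g where "g x = (norm x)\<^sup>2 - 2 * f x" for x
  obtain B where B: "\<And>x. norm (f x) \<le> norm x * B" using f.bounded by blast
  have lower: "- B\<^sup>2 \<le> g x" for x
  proof -
    have "2 * f x \<le> 2 * (norm x * B)" using B[of x] by simp
    moreover have "0 \<le> (norm x - B)\<^sup>2" by simp
    ultimately show ?thesis unfolding g_def power2_diff by (simp add: algebra_simps)
  qed
  have bdd: "bdd_below (g ` W)" using lower by (intro bdd_belowI2)
  have ne: "W \<noteq> {}" using W(2) subspace_0 by blast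
  define I where "I = Inf (g ` W)"
  have I_le: "I \<le> g x" if "x \<in> W" for x
    unfolding I_def using bdd that by (rule cINF_lower)
  have "\<exists>x\<in>W. g x < I + inverse (real (Suc n))" for n
    using cInf_lessD[of "g ` W" "I + inverse (real (Suc n))"] ne unfolding I_def[symmetric] by auto
  then obtain x where xW: "\<And>n. x n \<in> W" and xI: "\<And>n. g (x n) < I + inverse (real (Suc n))"
    by metis
  \<comment> \<open>The parallelogram identity, with the midpoint estimated by the infimum.\<close>
  have mid: "(norm (y - z))\<^sup>2 \<le> 2 * (g y - I) + 2 * (g z - I)" if "y \<in> W" "z \<in> W" for y z
  proof -
    have "(1/2) *\<^sub>R (y + z) \<in> W" using W(2) that by (intro subspace_scale subspace_add)
    then have "I \<le> g ((1/2) *\<^sub>R (y + z))" by (rule I_le)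
    also have "\<dots> = (norm (y + z))\<^sup>2 / 4 - f y - f z"
      unfolding g_def f.scaleR f.add norm_scaleR by (simp add: power_divide power_mult_distrib field_simps)
    finally show ?thesis
      by (simp add: g_def power2_norm_eq_inner inner_simps inner_commute[of z y] field_simps)
  qed
  have small: "(norm (x m - x n))\<^sup>2 \<le> 2 * inverse (real (Suc m)) + 2 * inverse (real (Suc n))" for m n
    using mid[OF xW xW, of m n] xI[of m] xI[of n] by simp
  have "Cauchy x"
  proof (rule metric_CauchyI)
    fix e :: real assume "e > 0"
    then have "e\<^sup>2 / 4 > 0" by simp
    then obtain M where M: "inverse (real (Suc M)) < e\<^sup>2 / 4" using reals_Archimedean by blast
    have "dist (x m) (x n) < e" if "m \<ge> M" "n \<ge> M" for m n
    proof -
      have "inverse (real (Suc m)) \<le> inverse (real (Suc M))"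
           "inverse (real (Suc n)) \<le> inverse (real (Suc M))"
        using that by (simp_all add: field_simps)
      then have "(norm (x m - x n))\<^sup>2 < e\<^sup>2" using small[of m n] M by linarith
      then show ?thesis using \<open>e > 0\<close> by (simp add: dist_norm power2_less_imp_less)
    qed
    then show "\<exists>M. \<forall>m\<ge>M. \<forall>n\<ge>M. dist (x m) (x n) < e" by blast
  qed
  then obtain p where p: "x \<longlonglongrightarrow> p" using Cauchy_convergent convergent_def by blast
  have pW: "p \<in> W" using W(1) xW p closed_sequentially by blast
  have gx: "(\<lambda>n. g (x n)) \<longlonglongrightarrow> g p" unfolding g_def by (intro tendsto_intros f.tendsto p)
  have "(\<lambda>n. I + inverse (real (Suc n))) \<longlonglongrightarrow> I + 0"
    by (intro tendsto_intros LIMSEQ_inverse_real_of_nat)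
  from LIMSEQ_le[OF gx this] have gp: "g p \<le> I"
    using xI by (simp add: less_imp_le)
  have "f y = inner y p" if "y \<in> W" for y
  proof -
    define c where "c = inner y p - f y"
    define s where "s = (norm y)\<^sup>2"
    \<comment> \<open>Nearly the minimiser \<open>- c / s\<close> of \<open>2 t c + t\<^sup>2 s\<close>; the added 1 spares the case \<open>s = 0\<close>.\<close>
    define t where "t = - c / (s + 1)"
    have s: "s \<ge> 0" by (simp add: s_def)
    have "p + t *\<^sub>R y \<in> W" using W(2) pW that by (intro subspace_add subspace_scale)
    then have "g p \<le> g (p + t *\<^sub>R y)" using gp I_le by fastforce
    moreover have "(norm (p + t *\<^sub>R y))\<^sup>2 = (norm p)\<^sup>2 + 2 * t * inner y p + t\<^sup>2 * s"
      unfolding power2_norm_eq_inner s_def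
      by (simp add: inner_simps inner_commute[of p y] power2_eq_square algebra_simps)
    ultimately have "0 \<le> 2 * t * c + t\<^sup>2 * s"
      by (simp add: g_def c_def f.add f.scaleR algebra_simps)
    also have "\<dots> = - c\<^sup>2 * (s + 2) / (s + 1)\<^sup>2"
      using s by (simp add: t_def power_divide field_simps power2_eq_square add_nonneg_eq_0_iff)
    finally have "c\<^sup>2 * (s + 2) / (s + 1)\<^sup>2 \<le> 0" by simp
    then have "c\<^sup>2 * (s + 2) \<le> 0" using s by (simp add: divide_le_0_iff)
    then have "c\<^sup>2 \<le> 0" using s by (simp add: mult_le_0_iff)
    then show ?thesis by (simp add: c_def)
  qed
  with pW that show ?thesis by blast
qed

text \<open>Bounded linear maps are weakly continuous: pairing with a vector is again a bounded
  functional, hence an inner product.\<close>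

lemma bounded_linear_weak_limit:
  fixes f :: "'a::complex_hilbert \<Rightarrow> 'b::real_inner"
  assumes f: "bounded_linear f" and u: "weakly_convergent_to us u"
  shows "(\<lambda>n. inner (f (us n)) h) \<longlonglongrightarrow> inner (f u) h"
proof -
  have "bounded_linear (\<lambda>v. inner (f v) h)"
    using f bounded_linear_compose bounded_linear_inner_left by blast
  then obtain p where "\<And>v. inner (f v) h = inner v p"
    using riesz_on_closed_subspace[of "\<lambda>v. inner (f v) h" UNIV] by auto
  then show ?thesis using u by (simp add: weakly_convergent_to_iff_inner)
qed

lemma compact_nat_box:
  "compact {x :: nat \<Rightarrow> real. \<forall>m. \<bar>x m\<bar> \<le> B}"
proof -
  have eq: "{x :: nat \<Rightarrow> real. \<forall>m. \<bar>x m\<bar> \<le> B} = PiE UNIV (\<lambda>m. {- B..B})"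
    by (auto simp: PiE_def Pi_def abs_le_iff; smt (verit))
  have "compactin (product_topology (\<lambda>i::nat. euclidean :: real topology) UNIV) (PiE UNIV (\<lambda>m. {- B..B}))"
    by (subst compactin_PiE) simp
  then show ?thesis unfolding eq euclidean_product_topology by simp
qed

text \<open>Compactness of a countable product of intervals provides a subsequence whose inner products
  with each term \<open>us m\<close> converge. The vectors tested successfully by this subsequence form a closed
  subspace \<open>S\<close> that contains the sequence, so projecting to \<open>S\<close> shows that every vector
  is tested successfully. The limit functional is represented by the weak limit.\<close>

lemma bounded_weakly_convergent_subsequence:
  fixes us :: "nat \<Rightarrow> 'a::complex_hilbert"
  assumes B: "\<And>n. norm (us n) \<le> B"
  obtains r u where "strict_mono r" "weakly_convergent_to (us \<circ> r) u"
proof -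
  have B0: "B \<ge> 0" using B[of 0] norm_ge_zero order_trans by blast
  define F where "F n = (\<lambda>m. inner (us n) (us m))" for n
  have "\<bar>F n m\<bar> \<le> B * B" for n m
    unfolding F_def using Cauchy_Schwarz_ineq2[of "us n" "us m"] mult_mono[OF B[of n] B[of m] B0]
    by simp
  then have "\<forall>n. F n \<in> {x. \<forall>m. \<bar>x m\<bar> \<le> B * B}" by simp
  then obtain l r where r: "strict_mono r" and l: "(F \<circ> r) \<longlonglongrightarrow> l"
    using compact_imp_seq_compact[OF compact_nat_box] unfolding seq_compact_def by metis
  have lm: "(\<lambda>n. inner (us (r n)) (us m)) \<longlonglongrightarrow> l m" for m
  proof -
    have "isCont (\<lambda>x :: nat \<Rightarrow> real. x m) l"
      using continuous_on_product_coordinates[of m] continuous_on_eq_continuous_at[OF open_UNIV]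
      by blast
    then show ?thesis using isCont_tendsto_compose[OF _ l, of "\<lambda>x. x m"] by (simp add: F_def)
  qed
  define S where "S = {v. convergent (\<lambda>n. inner (us (r n)) v)}"
  have S: "subspace S"
    unfolding subspace_def S_def
    by (auto simp: inner_simps intro: convergent_add convergent_mult convergent_const)
  have usS: "us m \<in> S" for m using lm unfolding S_def convergent_def by blast
  have clS: "closed S"
    unfolding closed_sequential_limits
  proof (intro allI impI, elim conjE)
    fix y v assume y: "\<forall>n. y n \<in> S" and yv: "y \<longlonglongrightarrow> v"
    have "Cauchy (\<lambda>n. inner (us (r n)) v)"
    proof (rule metric_CauchyI)
      fix e :: real assume e: "e > 0"
      then have "e / (3 * (B + 1)) > 0" using B0 by simp
      then obtain N where N: "norm (y N - v) < e / (3 * (B + 1))"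
        using yv unfolding LIMSEQ_iff by (metis order_refl)
      have near: "\<bar>inner (us (r n)) v - inner (us (r n)) (y N)\<bar> \<le> e / 3" for n
      proof -
        have "\<bar>inner (us (r n)) v - inner (us (r n)) (y N)\<bar> \<le> norm (us (r n)) * norm (y N - v)"
          using Cauchy_Schwarz_ineq2[of "us (r n)" "v - y N"]
          by (simp add: inner_simps norm_minus_commute)
        also have "\<dots> \<le> (B + 1) * (e / (3 * (B + 1)))"
          using B[of "r n"] N B0 by (intro mult_mono) auto
        also have "\<dots> = e / 3" using B0 by (simp add: field_simps)
        finally show ?thesis .
      qed
      have "Cauchy (\<lambda>n. inner (us (r n)) (y N))"
        using y unfolding S_def by (auto intro: convergent_Cauchy)
      then obtain M where M: "\<forall>m\<ge>M. \<forall>n\<ge>M. dist (inner (us (r m)) (y N)) (inner (us (r n)) (y N)) < e / 3"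
        using e unfolding Cauchy_def by (meson divide_pos_pos zero_less_numeral)
      have "dist (inner (us (r m)) v) (inner (us (r n)) v) < e" if "m \<ge> M" "n \<ge> M" for m n
        using M[rule_format, OF that] near[of m] near[of n] unfolding dist_real_def by linarith
      then show "\<exists>M. \<forall>m\<ge>M. \<forall>n\<ge>M. dist (inner (us (r m)) v) (inner (us (r n)) v) < e" by blast
    qed
    then show "v \<in> S" unfolding S_def by (simp add: Cauchy_convergent_iff)
  qed
  have conv: "convergent (\<lambda>n. inner (us (r n)) v)" for v
  proof -
    obtain p where p: "p \<in> S" "\<And>x. x \<in> S \<Longrightarrow> inner x v = inner x p"
      using riesz_on_closed_subspace[OF bounded_linear_inner_left clS S] by metis
    then show ?thesis using usS unfolding S_def by simp
  qed
  define f where "f v = lim (\<lambda>n. inner (us (r n)) v)" for v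
  have f: "(\<lambda>n. inner (us (r n)) v) \<longlonglongrightarrow> f v" for v
    using conv unfolding f_def by (simp add: convergent_LIMSEQ_iff)
  have "bounded_linear f"
  proof (rule bounded_linear_intro[where K = B])
    show "f (x + y) = f x + f y" for x y
      using LIMSEQ_unique[OF f[of "x + y"]] tendsto_add[OF f[of x] f[of y]] by (simp add: inner_simps)
    show "f (c *\<^sub>R x) = c *\<^sub>R f x" for c x
      using LIMSEQ_unique[OF f[of "c *\<^sub>R x"]] tendsto_mult[OF tendsto_const f[of x], of c]
      by (simp add: inner_simps)
    show "norm (f x) \<le> norm x * B" for x
    proof (rule LIMSEQ_le_const2[OF tendsto_norm[OF f[of x]]], intro exI allI impI)
      fix n
      show "norm (inner (us (r n)) x) \<le> norm x * B"
        using Cauchy_Schwarz_ineq2[of "us (r n)" x] mult_right_mono[OF B[of "r n"] norm_ge_zero[of x]]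
        by (simp add: mult.commute)
    qed
  qed
  then obtain u where "\<And>v. f v = inner v u"
    using riesz_on_closed_subspace[of f UNIV] by auto
  then have "weakly_convergent_to (us \<circ> r) u"
    using f by (simp add: weakly_convergent_to_iff_inner inner_commute)
  with r that show ?thesis by blast
qed

section \<open>Compact maps and weak convergence\<close>

lemma clinearD:
  assumes "clinear f"
  shows "f (x + y) = f x + f y" "f (c *\<^sub>C x) = c *\<^sub>C f x" "f 0 = 0"
    "f (x - y) = f x - f y" "f (sum g A) = (\<Sum>i\<in>A. f (g i))" "linear f"
proof -
  have f: "f (x + y) = f x + f y" "f (c *\<^sub>C x) = c *\<^sub>C f x" for x y c
    using assms unfolding Vector_Spaces.linear_iff by blast+
  show lin: "linear f" by (rule linearI) (simp_all add: f scaleR_scaleC)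
  show "f (x + y) = f x + f y" "f (c *\<^sub>C x) = c *\<^sub>C f x" by (rule f)+
  show "f 0 = 0" "f (x - y) = f x - f y" "f (sum g A) = (\<Sum>i\<in>A. f (g i))"
    using linear_0[OF lin] linear_diff[OF lin] linear_sum[OF lin] by blast+
qed

lemma bounded_on_unit_ball_imp_bounded_linear:
  fixes f :: "'a::real_normed_vector \<Rightarrow> 'b::real_normed_vector"
  assumes f: "linear f" and d: "d > 0" and B: "\<And>x. norm x \<le> d \<Longrightarrow> norm (f x) \<le> B"
  shows "bounded_linear f"
proof (rule bounded_linear_intro[where K = "B / d"])
  show "f (x + y) = f x + f y" "f (r *\<^sub>R x) = r *\<^sub>R f x" for x y r
    using linear_add[OF f] linear_scale[OF f] by blast+
  show "norm (f x) \<le> norm x * (B / d)" for x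
  proof (cases "x = 0")
    case True
    then show ?thesis using linear_0[OF f] by simp
  next
    case False
    then have "norm (f ((d / norm x) *\<^sub>R x)) \<le> B"
      using d by (intro B) simp
    then have "d / norm x * norm (f x) \<le> B"
      using d by (simp add: linear_scale[OF f])
    then show ?thesis using d False by (simp add: field_simps)
  qed
qed

lemma continuous_linear_imp_bounded_linear:
  fixes f :: "'a::real_normed_vector \<Rightarrow> 'b::real_normed_vector"
  assumes f: "linear f" and cont: "continuous_on UNIV f"
  shows "bounded_linear f"
proof -
  have "isCont f 0" using cont by (simp add: continuous_on_eq_continuous_at)
  then obtain d where "d > 0" "\<And>x. dist x 0 < d \<Longrightarrow> dist (f x) (f 0) < 1"
    unfolding continuous_at_eps_delta by (metis zero_less_one)
  then have "norm (f x) \<le> 1" if "norm x \<le> d / 2" for x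
    using that by (force simp: linear_0[OF f] intro: less_imp_le)
  with f \<open>d > 0\<close> show ?thesis
    by (intro bounded_on_unit_ball_imp_bounded_linear[of f "d / 2" 1]) auto
qed

lemma continuous_linear_map_bounded:
  "continuous_linear_map f \<Longrightarrow> bounded_linear f"
  unfolding continuous_linear_map_def
  using clinearD(6) continuous_linear_imp_bounded_linear by blast

lemma compact_linear_map_bounded:
  assumes "compact_linear_map T"
  shows "bounded_linear T"
proof -
  have "compact (closure (T ` cball 0 1))"
    using assms unfolding compact_linear_map_def by auto
  then have "bounded (T ` cball 0 1)"
    using compact_imp_bounded bounded_subset closure_subset by blast
  then obtain B where "\<And>x. norm x \<le> 1 \<Longrightarrow> norm (T x) \<le> B"
    unfolding bounded_iff by fastforce
  then show ?thesis
    using assms clinearD(6) unfolding compact_linear_map_def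
    by (intro bounded_on_unit_ball_imp_bounded_linear[of T 1 B]) auto
qed

lemma weakly_convergent_to_subseq:
  "weakly_convergent_to us u \<Longrightarrow> strict_mono r \<Longrightarrow> weakly_convergent_to (us \<circ> r) u"
  unfolding weakly_convergent_to_def comp_def
  using LIMSEQ_subseq_LIMSEQ[where f = r, unfolded comp_def] by blast

text \<open>Compactness turns weak into norm convergence along a subsequence; the norm limit is identified
  by weak continuity.\<close>

lemma compact_map_convergent_subsequence:
  fixes T :: "'a::complex_hilbert \<Rightarrow> 'b::complex_inner"
    and us :: "nat \<Rightarrow> 'a"
  assumes T: "compact_linear_map T" and B: "\<And>n. norm (us n) \<le> B"
  obtains r u where "strict_mono r" "weakly_convergent_to (us \<circ> r) u" "(\<lambda>n. T (us (r n))) \<longlonglongrightarrow> T u"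
proof -
  obtain r u where r: "strict_mono r" and u: "weakly_convergent_to (us \<circ> r) u"
    using bounded_weakly_convergent_subsequence[of us B] B by blast
  have "bounded (range us)" unfolding bounded_iff using B by blast
  then have "seq_compact (closure (T ` range us))"
    using T unfolding compact_linear_map_def by (intro compact_imp_seq_compact) auto
  moreover have "T ((us \<circ> r) n) \<in> closure (T ` range us)" for n
    using closure_subset by fastforce
  ultimately obtain z s where s: "strict_mono s" and z: "((\<lambda>n. T ((us \<circ> r) n)) \<circ> s) \<longlonglongrightarrow> z"
    using seq_compactE[of _ "\<lambda>n. T ((us \<circ> r) n)"] by metis
  have us: "weakly_convergent_to (us \<circ> (r \<circ> s)) u"
    using weakly_convergent_to_subseq[OF u s] by (simp add: o_assoc)
  have "inner z h = inner (T u) h" for h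
    using LIMSEQ_unique[OF _ bounded_linear_weak_limit[OF compact_linear_map_bounded[OF T] us]]
      tendsto_inner[OF z tendsto_const] by (simp add: o_def)
  then have "z = T u" by (metis vector_eq_rdot)
  with that[of "r \<circ> s" u] r s us z show ?thesis
    by (simp add: o_def strict_mono_def)
qed

text \<open>The subsequence must serve all members of a tuple at once, so it is refined member by
  member.\<close>

lemma compact_map_convergent_subsequence_tuple:
  fixes T :: "'a::complex_hilbert \<Rightarrow> 'b::complex_inner"
    and us :: "nat \<Rightarrow> nat \<Rightarrow> 'a"
  assumes T: "compact_linear_map T" and B: "\<And>i n. i < m \<Longrightarrow> norm (us n i) \<le> B"
  shows "\<exists>r u. strict_mono r \<and> (\<forall>i<m. weakly_convergent_to (\<lambda>n. us (r n) i) (u i) \<and>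
    (\<lambda>n. T (us (r n) i)) \<longlonglongrightarrow> T (u i))"
  using B
proof (induction m)
  case 0
  show ?case using strict_mono_id by auto
next
  case (Suc m)
  have "\<exists>r u. strict_mono r \<and> (\<forall>i<m. weakly_convergent_to (\<lambda>n. us (r n) i) (u i) \<and>
    (\<lambda>n. T (us (r n) i)) \<longlonglongrightarrow> T (u i))"
    by (rule Suc.IH) (simp add: Suc.prems)
  then obtain r u where r: "strict_mono r"
    and u: "\<And>i. i < m \<Longrightarrow> weakly_convergent_to (\<lambda>n. us (r n) i) (u i)"
      "\<And>i. i < m \<Longrightarrow> (\<lambda>n. T (us (r n) i)) \<longlonglongrightarrow> T (u i)" by blast
  obtain s w where s: "strict_mono s" and w: "weakly_convergent_to ((\<lambda>n. us (r n) m) \<circ> s) w"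
    "(\<lambda>n. T (us (r (s n)) m)) \<longlonglongrightarrow> T w"
    using compact_map_convergent_subsequence[OF T, of "\<lambda>n. us (r n) m" B] Suc.prems by auto
  have "weakly_convergent_to (\<lambda>n. us (r (s n)) i) (u i) \<and> (\<lambda>n. T (us (r (s n)) i)) \<longlonglongrightarrow> T (u i)"
    if "i < m" for i
    using weakly_convergent_to_subseq[OF u(1)[OF that] s] LIMSEQ_subseq_LIMSEQ[OF u(2)[OF that] s]
    by (simp add: o_def)
  with w have "\<forall>i<Suc m. weakly_convergent_to (\<lambda>n. us ((r \<circ> s) n) i) ((u(m := w)) i) \<and>
      (\<lambda>n. T (us ((r \<circ> s) n) i)) \<longlonglongrightarrow> T ((u(m := w)) i)"
    by (auto simp: o_def less_Suc_eq)
  moreover have "strict_mono (r \<circ> s)" using r s by (rule strict_mono_o)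
  ultimately show ?case by blast
qed

section \<open>Weakly convergent forms\<close>

text \<open>Weak convergence of forms tests full sequences only. A sequence indexed by the subsequence is
  completed by its own limit at the remaining indices.\<close>

lemma forms_converge_weakly_subseq:
  fixes b :: "nat \<Rightarrow> 'v::complex_inner \<Rightarrow> 'v \<Rightarrow> complex"
  assumes b: "forms_converge_weakly b b0" and N: "strict_mono N"
  shows "forms_converge_weakly (\<lambda>k. b (N k)) b0"
  unfolding forms_converge_weakly_def
proof (intro allI impI)
  fix v u :: 'v and us :: "nat \<Rightarrow> 'v" assume us: "weakly_convergent_to us u"
  define ws where "ws n = (if n \<in> range N then us (inv N n) else u)" for n
  have inj: "inj N" using N by (rule strict_mono_imp_inj_on)
  have wsN: "ws (N k) = us k" for k using inj by (simp add: ws_def)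
  have "weakly_convergent_to ws u"
    unfolding weakly_convergent_to_def LIMSEQ_iff
  proof (intro allI impI)
    fix v :: 'v and e :: real assume e: "e > 0"
    then obtain M where M: "\<And>k. k \<ge> M \<Longrightarrow> norm (cinner (us k) v - cinner u v) < e"
      using us unfolding weakly_convergent_to_def LIMSEQ_iff by metis
    have "norm (cinner (ws n) v - cinner u v) < e" if n: "n \<ge> N M" for n
    proof (cases "n \<in> range N")
      case True
      then obtain k where "n = N k" by blast
      with n N have "M \<le> k" by (simp add: strict_mono_less_eq)
      with M \<open>n = N k\<close> show ?thesis by (simp add: wsN)
    next
      case False
      then show ?thesis using e by (simp add: ws_def)
    qed
    then show "\<exists>M. \<forall>n\<ge>M. norm (cinner (ws n) v - cinner u v) < e" by blast
  qed
  then have "(\<lambda>n. b n (ws n) v) \<longlonglongrightarrow> b0 u v"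
    using b unfolding forms_converge_weakly_def by blast
  from LIMSEQ_subseq_LIMSEQ[OF this N] show "(\<lambda>k. b (N k) (us k) v) \<longlonglongrightarrow> b0 u v"
    by (simp add: o_def wsN)
qed

lemma sesquilinear_formD:
  assumes "sesquilinear_form b"
  shows "b (u + u') v = b u v + b u' v" "b (c *\<^sub>C u) v = c * b u v"
    "b u (v + v') = b u v + b u v'" "b u (c *\<^sub>C v) = cnj c * b u v"
    "b 0 v = 0" "b (u - u') v = b u v - b u' v" "b u (v - v') = b u v - b u v'"
proof -
  have b: "b (u + u') v = b u v + b u' v" "b (c *\<^sub>C u) v = c * b u v"
    "b u (v + v') = b u v + b u v'" "b u (c *\<^sub>C v) = cnj c * b u v" for u u' v v' c
    using assms unfolding sesquilinear_form_def by blast+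
  show "b (u + u') v = b u v + b u' v" "b (c *\<^sub>C u) v = c * b u v"
    "b u (v + v') = b u v + b u v'" "b u (c *\<^sub>C v) = cnj c * b u v" by (rule b)+
  show "b 0 v = 0" using b(1)[of 0 0 v] by simp
  show "b (u - u') v = b u v - b u' v" using b(1)[of "u - u'" u' v] by simp
  show "b u (v - v') = b u v - b u v'" using b(3)[of u "v - v'" v'] by simp
qed

text \<open>This lets a result on weakly convergent sequences be used for a single form. The functional
  \<open>\<lambda>w. b w v\<close> is bounded, hence weakly continuous.\<close>

lemma constant_form_converges_weakly:
  fixes b :: "'v::complex_hilbert \<Rightarrow> 'v \<Rightarrow> complex"
  assumes b: "sesquilinear_form b" and cont: "continuous_form b"
  shows "forms_converge_weakly (\<lambda>_. b) b"
  unfolding forms_converge_weakly_def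
proof (intro allI impI)
  fix v u :: 'v and us :: "nat \<Rightarrow> 'v" assume us: "weakly_convergent_to us u"
  have lin: "linear (\<lambda>w. b w v)"
    by (rule linearI) (simp_all add: sesquilinear_formD[OF b] scaleR_scaleC scaleC_complex_def)
  have "continuous_on UNIV (\<lambda>w. (\<lambda>(u, v). b u v) (w, v))"
    using cont unfolding continuous_form_def
    by (rule continuous_on_compose2) (auto intro!: continuous_intros)
  then have "bounded_linear (\<lambda>w. b w v)"
    using lin by (intro continuous_linear_imp_bounded_linear) simp_all
  from bounded_linear_weak_limit[OF this us] have "weakly_convergent_to (\<lambda>n. b (us n) v) (b u v)"
    by (simp add: weakly_convergent_to_iff_inner)
  then have "(\<lambda>n. cinner (b (us n) v) 1) \<longlonglongrightarrow> cinner (b u v) 1"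
    unfolding weakly_convergent_to_def by blast
  then show "(\<lambda>n. b (us n) v) \<longlonglongrightarrow> b u v" by (simp add: cinner_complex_def)
qed

section \<open>Families with orthonormal image under a compact map\<close>

definition orthonormal :: "nat \<Rightarrow> (nat \<Rightarrow> 'a::complex_inner) \<Rightarrow> bool"
  where "orthonormal m f \<longleftrightarrow> (\<forall>i<m. \<forall>l<m. cinner (f i) (f l) = (if i = l then 1 else 0))"

lemma orthonormal_norm: "orthonormal m f \<Longrightarrow> i < m \<Longrightarrow> norm (f i) = 1"
  using cinner_self[of "f i"] norm_ge_zero[of "f i"] unfolding orthonormal_def
  by (auto simp: power2_eq_1_iff simp flip: of_real_power)

lemma orthonormal_Suc:
  assumes f: "orthonormal m f" and x: "norm x = 1" "\<And>i. i < m \<Longrightarrow> cinner x (f i) = 0"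
  shows "orthonormal (Suc m) (f(m := x))"
proof -
  have "cinner (f i) x = 0" if "i < m" for i
    using x(2)[OF that] cinner_commute[of "f i" x] by simp
  then show ?thesis
    using f x by (auto simp: orthonormal_def less_Suc_eq cinner_self)
qed

lemma orthonormal_limit:
  assumes f: "\<And>k. orthonormal m (f k)" and g: "\<And>i. i < m \<Longrightarrow> (\<lambda>k. f k i) \<longlonglongrightarrow> g i"
  shows "orthonormal m g"
  unfolding orthonormal_def
proof (intro allI impI)
  fix i l assume il: "i < m" "l < m"
  then have "(\<lambda>k. cinner (f k i) (f k l)) = (\<lambda>k. if i = l then 1 else 0)"
    using f unfolding orthonormal_def by auto
  with tendsto_cinner[OF g[OF il(1)] g[OF il(2)]]
  show "cinner (g i) (g l) = (if i = l then 1 else 0)"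
    using LIMSEQ_unique[OF _ tendsto_const] by metis
qed

text \<open>Orthogonality refers to the images under \<open>T\<close>, while the subtraction takes place in the
  domain: the residual stays in any subspace that contains \<open>x\<close> and the family.\<close>

definition gram_schmidt_residual ::
    "('v::complex_vector \<Rightarrow> 'k::complex_inner) \<Rightarrow> nat \<Rightarrow> (nat \<Rightarrow> 'v) \<Rightarrow> 'v \<Rightarrow> 'v"
  where "gram_schmidt_residual T m e x = x - (\<Sum>i<m. cinner (T x) (T (e i)) *\<^sub>C e i)"

lemma gram_schmidt_residual_orthogonal:
  assumes T: "clinear T" and e: "orthonormal m (\<lambda>i. T (e i))" and l: "l < m"
  shows "cinner (T (gram_schmidt_residual T m e x)) (T (e l)) = 0"
proof -
  have "cinner (T (gram_schmidt_residual T m e x)) (T (e l)) =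
      cinner (T x) (T (e l)) - (\<Sum>i<m. cinner (T x) (T (e i)) * cinner (T (e i)) (T (e l)))"
    by (simp add: gram_schmidt_residual_def clinearD[OF T] cinner_diff_left cinner_sum_left cinner_scaleC_left)
  also have "(\<Sum>i<m. cinner (T x) (T (e i)) * cinner (T (e i)) (T (e l)))
      = (\<Sum>i<m. if i = l then cinner (T x) (T (e i)) else 0)"
    using e l unfolding orthonormal_def by (intro sum.cong) auto
  finally show ?thesis using l by simp
qed

lemma orthonormal_image_independent:
  fixes T :: "'v::complex_vector \<Rightarrow> 'k::complex_inner"
  assumes T: "clinear T" and e: "orthonormal m (\<lambda>i. T (e i))"
  shows "inj_on e {..<m}" "complex_vector.independent (e ` {..<m})"
proof -
  show inj: "inj_on e {..<m}"
    using e unfolding orthonormal_def inj_on_def by (metis lessThan_iff one_neq_zero)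
  show "complex_vector.independent (e ` {..<m})"
  proof (rule complex_vector.independent_if_scalars_zero)
    show "finite (e ` {..<m})" by simp
  next
    fix c x assume 0: "(\<Sum>x\<in>e ` {..<m}. c x *\<^sub>C x) = 0" and x: "x \<in> e ` {..<m}"
    then obtain l where l: "l < m" "x = e l" by auto
    have "(\<Sum>i<m. c (e i) *\<^sub>C e i) = 0"
      using 0 by (simp add: sum.reindex[OF inj])
    then have "0 = cinner (T (\<Sum>i<m. c (e i) *\<^sub>C e i)) (T (e l))"
      by (simp add: clinearD[OF T])
    also have "\<dots> = (\<Sum>i<m. c (e i) * cinner (T (e i)) (T (e l)))"
      by (simp add: clinearD[OF T] cinner_sum_left cinner_scaleC_left)
    also have "\<dots> = (\<Sum>i<m. if i = l then c (e i) else 0)"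
      using e l unfolding orthonormal_def by (intro sum.cong) auto
    finally show "c x = 0" using l by simp
  qed
qed

text \<open>Distinct members have distance \<open>sqrt 2\<close>, so no two of them share a ball of radius \<open>1/2\<close>,
  and finitely many such balls cover the set.\<close>

lemma finitely_many_orthonormal_in_compact:
  fixes C :: "'k::complex_inner set"
  assumes C: "compact C"
  shows "\<exists>N. \<forall>m f. orthonormal m f \<longrightarrow> (\<forall>i<m. f i \<in> C) \<longrightarrow> m \<le> N"
proof -
  obtain F where F: "finite F" "C \<subseteq> (\<Union>x\<in>F. ball x (1/2))"
    using compact_imp_seq_compact[OF C, THEN seq_compact_imp_totally_bounded] by (metis half_gt_zero zero_less_one)
  have "m \<le> card F" if f: "orthonormal m f" "\<forall>i<m. f i \<in> C" for m f
  proof (rule ccontr)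
    assume "\<not> m \<le> card F"
    have "\<forall>i\<in>{..<m}. \<exists>x\<in>F. dist x (f i) < 1/2" using f(2) F(2) by fastforce
    then obtain p where p: "\<And>i. i < m \<Longrightarrow> p i \<in> F" "\<And>i. i < m \<Longrightarrow> dist (p i) (f i) < 1/2"
      by (metis lessThan_iff)
    have "\<not> inj_on p {..<m}"
      using card_inj_on_le[of p "{..<m}" F] p(1) F(1) \<open>\<not> m \<le> card F\<close> by auto
    then obtain i l where il: "i < m" "l < m" "i \<noteq> l" "p i = p l" unfolding inj_on_def by auto
    have "inner (f i) (f l) = 0" "inner (f l) (f i) = 0"
      using f(1) il unfolding orthonormal_def inner_eq_Re_cinner by auto
    moreover have "inner (f i) (f i) = 1" "inner (f l) (f l) = 1"
      using f(1) il unfolding orthonormal_def inner_eq_Re_cinner by auto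
    ultimately have "(norm (f i - f l))\<^sup>2 = 2"
      by (simp add: power2_norm_eq_inner inner_diff_left inner_diff_right)
    moreover have "norm (f i - f l) < 1"
      using p(2)[OF il(1)] p(2)[OF il(2)] dist_triangle2[of "f i" "f l" "p i"] il(4)
      by (simp add: dist_norm dist_commute norm_minus_commute)
    then have "(norm (f i - f l))\<^sup>2 \<le> 1" by (simp add: power_le_one)
    ultimately show False by simp
  qed
  then show ?thesis by blast
qed

text \<open>The norm bound places vectors with orthonormal images in a fixed ball of the domain, whose image
  is relatively compact, so such families have bounded length. One of maximal length spans: the
  Gram-Schmidt residual of any vector must have image 0, and then is 0 by the norm bound. In
  particular \<open>K\<close> is finite dimensional, so that \<open>cdim K\<close> is its genuine dimension and not the value 0
  assigned to infinite-dimensional spaces.\<close>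

lemma elliptic_subspace_orthonormal_basis:
  fixes T :: "'v::complex_hilbert \<Rightarrow> 'k::complex_hilbert"
  assumes T: "compact_linear_map T" and K: "complex_vector.subspace K"
    and C: "\<And>u. u \<in> K \<Longrightarrow> norm u \<le> C * norm (T u)"
  shows "\<exists>e. orthonormal (cdim K) (\<lambda>i. T (e i)) \<and> (\<forall>i<cdim K. e i \<in> K)"
    and "\<And>m e. orthonormal m (\<lambda>i. T (e i)) \<Longrightarrow> (\<And>i. i < m \<Longrightarrow> e i \<in> K) \<Longrightarrow> m \<le> cdim K"
proof -
  have lin: "clinear T" using T unfolding compact_linear_map_def by blast
  define P where "P m \<longleftrightarrow> (\<exists>e. orthonormal m (\<lambda>i. T (e i)) \<and> (\<forall>i<m. e i \<in> K))" for m
  have "compact (closure (T ` cball 0 C))"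
    using T unfolding compact_linear_map_def by auto
  then obtain N where N: "\<And>m f. orthonormal m f \<Longrightarrow> \<forall>i<m. f i \<in> closure (T ` cball 0 C) \<Longrightarrow> m \<le> N"
    using finitely_many_orthonormal_in_compact by metis
  have bnd: "m \<le> N" if Pm: "P m" for m
  proof -
    obtain e where e: "orthonormal m (\<lambda>i. T (e i))" "\<And>i. i < m \<Longrightarrow> e i \<in> K"
      using Pm unfolding P_def by blast
    have "T (e i) \<in> closure (T ` cball 0 C)" if "i < m" for i
    proof -
      have "norm (e i) \<le> C" using C[OF e(2)[OF that]] orthonormal_norm[OF e(1) that] by simp
      then show ?thesis by (intro subsetD[OF closure_subset] imageI) simp
    qed
    then show ?thesis using N[OF e(1)] by simp
  qed
  have "P 0" unfolding P_def orthonormal_def by simp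
  define d where "d = (GREATEST m. P m)"
  have Pd: "P d" unfolding d_def using GreatestI_nat[of P 0 N] \<open>P 0\<close> bnd by blast
  have max: "m \<le> d" if "P m" for m unfolding d_def using Greatest_le_nat[of P m N] that bnd by blast
  obtain e where e: "orthonormal d (\<lambda>i. T (e i))" and eK: "\<And>i. i < d \<Longrightarrow> e i \<in> K"
    using Pd unfolding P_def by blast
  have "K \<subseteq> complex_vector.span (e ` {..<d})"
  proof
    fix x assume x: "x \<in> K"
    define s where "s = (\<Sum>i<d. cinner (T x) (T (e i)) *\<^sub>C e i)"
    define y where "y = gram_schmidt_residual T d e x"
    have ys: "y = x - s" by (simp add: y_def s_def gram_schmidt_residual_def)
    have "s \<in> K" unfolding s_def
      using eK by (intro complex_vector.subspace_sum[OF K] complex_vector.subspace_scale[OF K]) auto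
    then have yK: "y \<in> K" unfolding ys using x by (intro complex_vector.subspace_diff[OF K])
    have orth: "cinner (T y) (T (e l)) = 0" if "l < d" for l
      unfolding y_def using lin e that by (rule gram_schmidt_residual_orthogonal)
    have "T y = 0"
    proof (rule ccontr)
      assume Ty: "T y \<noteq> 0"
      define z where "z = complex_of_real (1 / norm (T y)) *\<^sub>C y"
      have "norm (T z) = 1" using Ty by (simp add: z_def clinearD[OF lin] norm_scaleC norm_divide)
      moreover have "cinner (T z) (T (e i)) = 0" if "i < d" for i
        using orth[OF that] by (simp add: z_def clinearD[OF lin] cinner_scaleC_left)
      ultimately have "orthonormal (Suc d) ((\<lambda>i. T (e i))(d := T z))"
        using orthonormal_Suc[OF e] by blast
      then have "orthonormal (Suc d) (\<lambda>i. T ((e(d := z)) i))"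
        by (simp add: fun_upd_def if_distrib cong: if_cong)
      moreover have "z \<in> K" unfolding z_def using yK by (intro complex_vector.subspace_scale[OF K])
      ultimately have "P (Suc d)"
        unfolding P_def using eK by (intro exI[of _ "e(d := z)"]) (auto simp: less_Suc_eq)
      then show False using max by fastforce
    qed
    then have "x = s" using C[OF yK] ys by simp
    moreover have "s \<in> complex_vector.span (e ` {..<d})" unfolding s_def
      by (intro complex_vector.span_sum complex_vector.span_scale complex_vector.span_base imageI)
    ultimately show "x \<in> complex_vector.span (e ` {..<d})" by simp
  qed
  then have "cdim K = card (e ` {..<d})"
    using eK orthonormal_image_independent(2)[OF lin e]
    by (intro complex_vector.basis_card_eq_dim[symmetric]) auto
  then have "cdim K = d"
    using card_image[OF orthonormal_image_independent(1)[OF lin e]] by simp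
  with Pd max have "P (cdim K)" and "\<And>m. P m \<Longrightarrow> m \<le> cdim K" by simp_all
  then show "\<exists>e. orthonormal (cdim K) (\<lambda>i. T (e i)) \<and> (\<forall>i<cdim K. e i \<in> K)"
    and "\<And>m e. orthonormal m (\<lambda>i. T (e i)) \<Longrightarrow> (\<And>i. i < m \<Longrightarrow> e i \<in> K) \<Longrightarrow> m \<le> cdim K"
    unfolding P_def by blast+
qed

section \<open>Uniform lower bounds\<close>

text \<open>Orthonormality survives because the images under \<open>T\<close> converge in norm. The other conditions
  on the limits are linear and survive weak convergence: the images under \<open>j\<close> tend to 0, and \<open>b k\<close>
  annihilates the kernel of \<open>j\<close> for every \<open>k\<close>.\<close>

lemma weak_limits_orthonormal_in_limit_kernel:
  fixes j :: "'v::complex_hilbert \<Rightarrow> 'h::complex_hilbert" and T :: "'v \<Rightarrow> 'k::complex_hilbert"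
  assumes j: "continuous_linear_map j" and T: "compact_linear_map T"
    and b: "forms_converge_weakly b b0"
    and bnd: "\<And>k i. i < m \<Longrightarrow> norm (e k i) \<le> B"
    and orth: "\<And>k. orthonormal m (\<lambda>i. T (e k i))"
    and mem: "\<And>k i. i < m \<Longrightarrow> e k i \<in> form_space j (b k)"
    and jz: "\<And>i. i < m \<Longrightarrow> (\<lambda>k. j (e k i)) \<longlonglongrightarrow> 0"
  obtains w where "orthonormal m (\<lambda>i. T (w i))"
    "\<And>i. i < m \<Longrightarrow> w i \<in> form_space j b0 \<inter> null_space_of j"
proof -
  obtain r w where r: "strict_mono r"
    and weak: "\<And>i. i < m \<Longrightarrow> weakly_convergent_to (\<lambda>n. e (r n) i) (w i)"
    and strong: "\<And>i. i < m \<Longrightarrow> (\<lambda>n. T (e (r n) i)) \<longlonglongrightarrow> T (w i)"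
    using compact_map_convergent_subsequence_tuple[OF T, of m e B] bnd by blast
  have "orthonormal m (\<lambda>i. T (w i))"
    by (rule orthonormal_limit[where f = "\<lambda>n i. T (e (r n) i)"]) (simp_all add: orth strong)
  moreover have "w i \<in> form_space j b0 \<inter> null_space_of j" if i: "i < m" for i
  proof
    have "(\<lambda>n. inner (j (e (r n) i)) (j (w i))) \<longlonglongrightarrow> inner (j (w i)) (j (w i))"
      using continuous_linear_map_bounded[OF j] weak[OF i] by (rule bounded_linear_weak_limit)
    moreover have "(\<lambda>n. inner (j (e (r n) i)) (j (w i))) \<longlonglongrightarrow> inner 0 (j (w i))"
      using LIMSEQ_subseq_LIMSEQ[OF jz[OF i] r] by (intro tendsto_inner) (simp_all add: o_def)
    ultimately have "inner (j (w i)) (j (w i)) = inner 0 (j (w i))" by (rule LIMSEQ_unique)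
    then show "w i \<in> null_space_of j" by (simp add: null_space_of_def)
    have "b0 (w i) v = 0" if v: "v \<in> null_space_of j" for v
    proof (rule LIMSEQ_unique)
      show "(\<lambda>n. b (r n) (e (r n) i) v) \<longlonglongrightarrow> b0 (w i) v"
        using forms_converge_weakly_subseq[OF b r] weak[OF i] unfolding forms_converge_weakly_def by blast
      show "(\<lambda>n. b (r n) (e (r n) i) v) \<longlonglongrightarrow> 0"
        using mem[OF i] v by (simp add: form_space_def)
    qed
    then show "w i \<in> form_space j b0" by (simp add: form_space_def)
  qed
  ultimately show ?thesis using that by blast
qed

lemma subspace_form_space_kernel:
  assumes "sesquilinear_form b" "clinear j"
  shows "complex_vector.subspace (form_space j b \<inter> null_space_of j)"
  unfolding complex_vector.subspace_def form_space_def null_space_of_def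
  by (simp add: sesquilinear_formD[OF assms(1)] clinearD[OF assms(2)])

text \<open>Covers both the kernels, where the form vanishes, and the vectors on which a lower bound
  fails.\<close>

lemma norm_bound_of_nonpositive:
  assumes ell: "\<mu> * (norm u)\<^sup>2 \<le> Re (b u u) + \<omega> * (norm (T u))\<^sup>2" and \<mu>: "\<mu> > 0" "\<omega> > 0"
    and neg: "Re (b u u) \<le> 0"
  shows "norm u \<le> sqrt (\<omega> / \<mu>) * norm (T u)"
proof -
  have "\<mu> * (norm u)\<^sup>2 \<le> \<omega> * (norm (T u))\<^sup>2" using ell neg by simp
  then have "(norm u)\<^sup>2 \<le> \<omega> / \<mu> * (norm (T u))\<^sup>2" using \<mu> by (simp add: field_simps)
  also have "\<dots> = (sqrt (\<omega> / \<mu>) * norm (T u))\<^sup>2" using \<mu> by (simp add: power_mult_distrib)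
  finally show ?thesis by (rule power2_le_imp_le) (use \<mu> in simp)
qed

lemma form_kernel_isotropic:
  "u \<in> form_space j b \<inter> null_space_of j \<Longrightarrow> b u u = 0"
  by (simp add: form_space_def)

text \<open>Needed for the kernel of the limit form to be finite dimensional.\<close>

lemma limit_form_elliptic:
  fixes b :: "nat \<Rightarrow> 'v::complex_hilbert \<Rightarrow> 'v \<Rightarrow> complex"
  assumes "forms_converge_weakly b b0"
    and "\<And>n u. \<mu> * (norm u)\<^sup>2 \<le> Re (b n u u) + \<omega> * (norm (T u))\<^sup>2"
  shows "\<mu> * (norm u)\<^sup>2 \<le> Re (b0 u u) + \<omega> * (norm (T u))\<^sup>2"
proof -
  have "weakly_convergent_to (\<lambda>_. u) u" unfolding weakly_convergent_to_def by simp
  then have "(\<lambda>n. b n u u) \<longlonglongrightarrow> b0 u u" using assms(1) unfolding forms_converge_weakly_def by blast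
  then have "(\<lambda>n. Re (b n u u) + \<omega> * (norm (T u))\<^sup>2) \<longlonglongrightarrow> Re (b0 u u) + \<omega> * (norm (T u))\<^sup>2"
    by (intro tendsto_intros)
  then show ?thesis using LIMSEQ_le_const assms(2) by blast
qed

text \<open>A Gram-Schmidt step against the \<open>e i\<close>, then normalisation. The subtracted vector \<open>s\<close>
  lies in \<open>V(b) \<inter> ker j\<close>, which is \<open>b\<close>-orthogonal to \<open>u\<close> and to itself; so neither \<open>b u u\<close> nor
  \<open>j u\<close> changes. By ellipticity a negative vector has nonzero image under \<open>T\<close>, and
  once this image has norm 1 ellipticity also bounds \<open>w\<close> and \<open>j w\<close>.\<close>

lemma negative_vector_extends_orthonormal_basis:
  fixes j :: "'v::complex_hilbert \<Rightarrow> 'h::complex_hilbert" and T :: "'v \<Rightarrow> 'k::complex_hilbert"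
  assumes j: "clinear j" and T: "clinear T"
    and b: "sesquilinear_form b" "symmetric_form b"
    and ell: "\<And>u. \<mu> * (norm u)\<^sup>2 \<le> Re (b u u) + \<omega> * (norm (T u))\<^sup>2" and \<mu>: "\<mu> > 0" "\<omega> > 0"
    and orth: "orthonormal d (\<lambda>i. T (e i))"
    and eK: "\<And>i. i < d \<Longrightarrow> e i \<in> form_space j b \<inter> null_space_of j"
    and u: "u \<in> form_space j b" and c: "c \<ge> 0" "Re (b u u) + c * (norm (j u))\<^sup>2 < 0"
  obtains w where "w \<in> form_space j b" "norm (T w) = 1"
    "\<And>i. i < d \<Longrightarrow> cinner (T w) (T (e i)) = 0"
    "norm w \<le> sqrt (\<omega> / \<mu>)" "c * (norm (j w))\<^sup>2 \<le> \<omega>"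
proof -
  define K where "K = form_space j b \<inter> null_space_of j"
  have K: "complex_vector.subspace K" unfolding K_def using b(1) j by (rule subspace_form_space_kernel)
  define s where "s = (\<Sum>i<d. cinner (T u) (T (e i)) *\<^sub>C e i)"
  define x where "x = u - s"
  have x_res: "x = gram_schmidt_residual T d e u"
    by (simp add: x_def s_def gram_schmidt_residual_def)
  have sK: "s \<in> K" unfolding s_def using eK unfolding K_def[symmetric]
    by (intro complex_vector.subspace_sum[OF K] complex_vector.subspace_scale[OF K]) auto
  then have s: "j s = 0" "\<And>v. j v = 0 \<Longrightarrow> b s v = 0"
    unfolding K_def form_space_def null_space_of_def by auto
  have us: "b u s = 0" using u s(1) unfolding form_space_def null_space_of_def by simp
  have su: "b s u = 0" using us b(2) unfolding symmetric_form_def by (metis complex_cnj_zero)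
  have jx: "j x = j u" by (simp add: x_def clinearD[OF j] s(1))
  have bx: "b x x = b u u" using us su s by (simp add: x_def sesquilinear_formD[OF b(1)])
  have xV: "x \<in> form_space j b"
    using u s(2) by (simp add: x_def form_space_def null_space_of_def sesquilinear_formD[OF b(1)])
  have neg: "Re (b x x) + c * (norm (j x))\<^sup>2 < 0" using c(2) by (simp add: bx jx)
  have "T x \<noteq> 0"
  proof
    assume "T x = 0"
    moreover have "0 \<le> \<mu> * (norm x)\<^sup>2" using \<mu> by simp
    ultimately have "0 \<le> Re (b x x)" using ell[of x] by simp
    moreover have "0 \<le> c * (norm (j x))\<^sup>2" using c(1) by simp
    ultimately show False using neg by linarith
  qed
  define t where "t = 1 / norm (T x)"
  have t: "t > 0" using \<open>T x \<noteq> 0\<close> by (simp add: t_def)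
  define w where "w = complex_of_real t *\<^sub>C x"
  have bw: "b w w = complex_of_real (t\<^sup>2) * b x x"
    by (simp add: w_def sesquilinear_formD[OF b(1)] power2_eq_square)
  have jw: "norm (j w) = t * norm (j x)" using t by (simp add: w_def clinearD[OF j] norm_scaleC)
  have "Re (b w w) + c * (norm (j w))\<^sup>2 = t\<^sup>2 * (Re (b x x) + c * (norm (j x))\<^sup>2)"
    by (simp add: bw jw power_mult_distrib algebra_simps)
  then have negw: "Re (b w w) + c * (norm (j w))\<^sup>2 \<le> 0"
    using mult_nonneg_nonpos[of "t\<^sup>2" "Re (b x x) + c * (norm (j x))\<^sup>2"] neg by simp
  have Tw: "norm (T w) = 1"
    using \<open>T x \<noteq> 0\<close> by (simp add: w_def t_def clinearD[OF T] norm_scaleC norm_divide)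
  have "0 \<le> c * (norm (j w))\<^sup>2" using c(1) by simp
  then have "norm w \<le> sqrt (\<omega> / \<mu>) * norm (T w)"
    using negw by (intro norm_bound_of_nonpositive[of \<mu> w b \<omega> T, OF ell \<mu>]) linarith
  moreover have "c * (norm (j w))\<^sup>2 \<le> \<omega>"
  proof -
    have "0 \<le> \<mu> * (norm w)\<^sup>2" using \<mu> by simp
    then show ?thesis using ell[of w] negw Tw by simp
  qed
  moreover have "cinner (T w) (T (e i)) = 0" if "i < d" for i
    using gram_schmidt_residual_orthogonal[OF T orth that, of u]
    by (simp add: w_def x_res clinearD[OF T] cinner_scaleC_left)
  moreover have "w \<in> form_space j b"
    using xV by (simp add: w_def form_space_def sesquilinear_formD[OF b(1)])
  ultimately show ?thesis using that Tw by simp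
qed

text \<open>The constant and the index of the form are the same \<open>k\<close>, so that a failure for every
  \<open>k\<close> provides vectors whose images under \<open>j\<close> tend to 0. A lower bound for one member is all that is
  claimed; the choice of the sequence makes it useful.\<close>

lemma converging_forms_bounded_below:
  fixes j :: "'v::complex_hilbert \<Rightarrow> 'h::complex_hilbert" and T :: "'v \<Rightarrow> 'k::complex_hilbert"
  assumes j: "continuous_linear_map j" and T: "compact_linear_map T"
    and b: "\<And>n. sesquilinear_form (b n)" "\<And>n. symmetric_form (b n)"
    and b0: "sesquilinear_form b0"
    and ell: "uniformly_elliptic T b" and conv: "forms_converge_weakly b b0"
    and dim: "(\<lambda>n. cdim (form_space j (b n) \<inter> null_space_of j)) \<longlonglongrightarrow>
      cdim (form_space j b0 \<inter> null_space_of j)"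
  shows "\<exists>k. \<forall>u\<in>form_space j (b k). 0 \<le> Re (b k u u) + real k * (norm (j u))\<^sup>2"
proof (rule ccontr)
  assume "\<not> ?thesis"
  then have neg: "\<exists>u\<in>form_space j (b k). Re (b k u u) + real k * (norm (j u))\<^sup>2 < 0" for k
    by (meson not_le)
  have linj: "clinear j" and linT: "clinear T"
    using j T unfolding continuous_linear_map_def compact_linear_map_def by blast+
  define K where "K n = form_space j (b n) \<inter> null_space_of j" for n
  define K0 where "K0 = form_space j b0 \<inter> null_space_of j"
  define d where "d = cdim K0"
  obtain \<mu> \<omega> where \<mu>: "\<mu> > 0" "\<omega> > 0"
    and ell: "\<And>n u. \<mu> * (norm u)\<^sup>2 \<le> Re (b n u u) + \<omega> * (norm (T u))\<^sup>2"
    using ell unfolding uniformly_elliptic_def by blast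
  define C where "C = sqrt (\<omega> / \<mu>)"
  have boundK: "norm u \<le> C * norm (T u)" if "u \<in> K n" for n u
    using norm_bound_of_nonpositive[of \<mu> u "b n" \<omega> T, OF ell \<mu>] form_kernel_isotropic[of u j "b n"] that
    unfolding C_def K_def by simp
  have boundK0: "norm u \<le> C * norm (T u)" if "u \<in> K0" for u
    using norm_bound_of_nonpositive[of \<mu> u b0 \<omega> T, OF limit_form_elliptic[OF conv ell] \<mu>]
      form_kernel_isotropic[of u j b0] that unfolding C_def K0_def by simp
  have subK: "complex_vector.subspace (K n)" "complex_vector.subspace K0" for n
    unfolding K_def K0_def using b(1) b0 linj by (simp_all add: subspace_form_space_kernel)
  obtain M where M: "\<And>n. n \<ge> M \<Longrightarrow> cdim (K n) = d"
    using dim unfolding d_def K_def K0_def tendsto_discrete eventually_sequentially by blast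
  \<comment> \<open>One vector more than the dimension of the limit kernel.\<close>
  define Q where "Q n e \<longleftrightarrow> orthonormal (Suc d) (\<lambda>i. T (e i)) \<and>
      (\<forall>i<Suc d. norm (e i) \<le> C \<and> e i \<in> form_space j (b n) \<and> real n * (norm (j (e i)))\<^sup>2 \<le> \<omega>)"
    for n e
  \<comment> \<open>Indices start at \<open>Suc M\<close>, not \<open>M\<close>, so that it is possible to divide by them.\<close>
  have "\<exists>e. Q (k + Suc M) e" for k
  proof -
    define n where "n = k + Suc M"
    have n: "n \<ge> M" by (simp add: n_def)
    obtain e where e: "orthonormal d (\<lambda>i. T (e i))" and eK: "\<And>i. i < d \<Longrightarrow> e i \<in> K n"
      using elliptic_subspace_orthonormal_basis(1)[OF T subK(1)[of n] boundK[of _ n]]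
      unfolding M[OF n] by auto
    obtain u where u: "u \<in> form_space j (b n)" "Re (b n u u) + real n * (norm (j u))\<^sup>2 < 0"
      using neg by blast
    have eK': "e i \<in> form_space j (b n) \<inter> null_space_of j" if "i < d" for i
      using eK[OF that] by (simp add: K_def)
    obtain w where w: "w \<in> form_space j (b n)" "norm (T w) = 1"
      "\<And>i. i < d \<Longrightarrow> cinner (T w) (T (e i)) = 0"
      "norm w \<le> C" "real n * (norm (j w))\<^sup>2 \<le> \<omega>"
      using negative_vector_extends_orthonormal_basis[OF linj linT b(1)[of n] b(2)[of n] ell \<mu> e
          eK' u(1) of_nat_0_le_iff u(2)]
      unfolding C_def by blast
    have "(\<lambda>i. T ((e(d := w)) i)) = (\<lambda>i. T (e i))(d := T w)" by auto
    then have "orthonormal (Suc d) (\<lambda>i. T ((e(d := w)) i))"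
      using orthonormal_Suc[OF e w(2,3)] by simp
    moreover have "norm (e i) \<le> C" if "i < d" for i
      using boundK[OF eK[OF that]] orthonormal_norm[OF e that] by simp
    moreover have "j (e i) = 0" "e i \<in> form_space j (b n)" if "i < d" for i
      using eK[OF that] unfolding K_def null_space_of_def by auto
    ultimately show ?thesis using w \<mu> unfolding n_def[symmetric] Q_def
      by (intro exI[of _ "e(d := w)"]) (auto simp: less_Suc_eq)
  qed
  then obtain e where Q: "\<And>n. Q (n + Suc M) (e n)" by metis
  have orth: "orthonormal (Suc d) (\<lambda>i. T (e n i))" for n
    using Q[of n] unfolding Q_def by blast
  have e: "norm (e n i) \<le> C" "e n i \<in> form_space j (b (n + Suc M))"
    "real (n + Suc M) * (norm (j (e n i)))\<^sup>2 \<le> \<omega>" if "i < Suc d" for n i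
    using Q[of n] that unfolding Q_def by blast+
  have shift: "strict_mono (\<lambda>n. n + Suc M)" by (simp add: strict_mono_def)
  have jz: "(\<lambda>n. j (e n i)) \<longlonglongrightarrow> 0" if i: "i < Suc d" for i
  proof -
    have bound: "(norm (j (e n i)))\<^sup>2 \<le> \<omega> * inverse (real (Suc n))" for n
    proof -
      have "real (Suc n) * (norm (j (e n i)))\<^sup>2 \<le> real (n + Suc M) * (norm (j (e n i)))\<^sup>2"
        by (intro mult_right_mono) auto
      also have "\<dots> \<le> \<omega>" using i by (rule e(3))
      finally show ?thesis by (simp add: field_simps)
    qed
    have lim: "(\<lambda>n. \<omega> * inverse (real (Suc n))) \<longlonglongrightarrow> 0"
      using tendsto_mult[OF tendsto_const LIMSEQ_inverse_real_of_nat, of \<omega>] by simp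
    have "(\<lambda>n. (norm (j (e n i)))\<^sup>2) \<longlonglongrightarrow> 0"
      by (rule tendsto_sandwich[OF _ _ tendsto_const lim])
        (intro always_eventually allI zero_le_power2 bound)+
    from tendsto_real_sqrt[OF this] have "(\<lambda>n. norm (j (e n i))) \<longlonglongrightarrow> 0" by simp
    then show ?thesis by (rule tendsto_norm_zero_cancel)
  qed
  obtain w where w: "orthonormal (Suc d) (\<lambda>i. T (w i))" "\<And>i. i < Suc d \<Longrightarrow> w i \<in> K0"
    using weak_limits_orthonormal_in_limit_kernel[OF j T forms_converge_weakly_subseq[OF conv shift],
        of "Suc d" e C, OF e(1) orth e(2) jz] unfolding K0_def by blast
  have "Suc d \<le> cdim K0"
    using elliptic_subspace_orthonormal_basis(2)[OF T subK(2) boundK0 w] by blast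
  then show False by (simp add: d_def)
qed

text \<open>Only finitely many forms escape a common constant, and each of those has a constant of its own.
  Both claims come from \<open>converging_forms_bounded_below\<close>, for a subsequence and for a
  constant sequence.\<close>

lemma forms_uniformly_bounded_below:
  fixes j :: "'v::complex_hilbert \<Rightarrow> 'h::complex_hilbert" and T :: "'v \<Rightarrow> 'k::complex_hilbert"
  assumes j: "continuous_linear_map j" and T: "compact_linear_map T"
    and b: "\<And>n. sesquilinear_form (b n)" "\<And>n. symmetric_form (b n)" "\<And>n. continuous_form (b n)"
    and b0: "sesquilinear_form b0"
    and ell: "uniformly_elliptic T b" and conv: "forms_converge_weakly b b0"
    and dim: "(\<lambda>n. cdim (form_space j (b n) \<inter> null_space_of j)) \<longlonglongrightarrow>
      cdim (form_space j b0 \<inter> null_space_of j)"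
  shows "\<exists>k. \<forall>n. \<forall>u\<in>form_space j (b n). 0 \<le> Re (b n u u) + real k * (norm (j u))\<^sup>2"
proof -
  define P where "P k n \<longleftrightarrow> (\<forall>u\<in>form_space j (b n). 0 \<le> Re (b n u u) + real k * (norm (j u))\<^sup>2)" for k n
  have mono: "P l n" if "P k n" "k \<le> l" for k l n
    unfolding P_def
  proof
    fix u assume "u \<in> form_space j (b n)"
    then have "0 \<le> Re (b n u u) + real k * (norm (j u))\<^sup>2" using that unfolding P_def by blast
    also have "\<dots> \<le> Re (b n u u) + real l * (norm (j u))\<^sup>2" using that by (simp add: mult_right_mono)
    finally show "0 \<le> Re (b n u u) + real l * (norm (j u))\<^sup>2" .
  qed
  have sub: "uniformly_elliptic T (\<lambda>k. b (N k))" for N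
    using ell unfolding uniformly_elliptic_def by blast
  have single: "\<exists>k. P k n" for n
    unfolding P_def
    using converging_forms_bounded_below[OF j T b(1,2) b(1) sub[of "\<lambda>_. n"]
        constant_form_converges_weakly[OF b(1,3)] tendsto_const] .
  have "\<exists>k. \<forall>n\<ge>k. P k n"
  proof (rule ccontr)
    assume "\<not> ?thesis"
    then have fail: "\<exists>n\<ge>k. \<not> P k n" for k by blast
    \<comment> \<open>Failing constants can be chosen along strictly increasing indices, since failure for a
      large constant implies failure for every smaller one.\<close>
    have "\<exists>N. \<forall>k. \<not> P k (N k) \<and> N k < N (Suc k)"
    proof (rule dependent_nat_choice)
      show "\<exists>n. \<not> P 0 n" using fail by blast
      show "\<exists>y. \<not> P (Suc k) y \<and> x < y" for x k
        using fail[of "Suc k + Suc x"] mono[of "Suc k" _ "Suc k + Suc x"]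
        by (metis Suc_le_lessD le_add1 le_add2 le_trans)
    qed
    then obtain N where N: "\<And>k. \<not> P k (N k)" "strict_mono N" by (auto simp: strict_mono_Suc_iff)
    have "\<exists>k. P k (N k)"
      unfolding P_def
      using converging_forms_bounded_below[OF j T b(1,2) b0 sub[of N]
          forms_converge_weakly_subseq[OF conv N(2)]] LIMSEQ_subseq_LIMSEQ[OF dim N(2)]
      by (simp add: o_def)
    with N(1) show False by blast
  qed
  then obtain k where k: "\<And>n. n \<ge> k \<Longrightarrow> P k n" by blast
  obtain K where K: "\<And>n. P (K n) n" using single by metis
  define l where "l = k + (\<Sum>n<k. K n)"
  have "P l n" for n
  proof (cases "n < k")
    case True
    then have "K n \<le> (\<Sum>n<k. K n)" by (intro member_le_sum) auto
    then show ?thesis using mono[OF K[of n], of l] by (simp add: l_def)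
  next
    case False
    then show ?thesis using mono[OF k[of n], of l] by (simp add: l_def)
  qed
  then show ?thesis unfolding P_def by blast
qed

theorem theorem5p13:
  fixes j :: "'v::complex_hilbert \<Rightarrow> 'h::complex_hilbert"
    and jt :: "'v \<Rightarrow> 'k::complex_hilbert"
    and a :: "'v \<Rightarrow> 'v \<Rightarrow> complex"
    and an :: "nat \<Rightarrow> 'v \<Rightarrow> 'v \<Rightarrow> complex"
  assumes "continuous_linear_map j"
    and "compact_linear_map jt"
    and "sesquilinear_form a" and "symmetric_form a" and "continuous_form a"
    and "\<And>n. sesquilinear_form (an n)" and "\<And>n. symmetric_form (an n)"
    and "\<And>n. continuous_form (an n)"
    and "uniformly_elliptic jt an"
    and "forms_converge_weakly an a"
    and "(\<lambda>n. cdim (form_space j (an n) \<inter> null_space_of j)) \<longlonglongrightarrow> cdim (form_space j a \<inter> null_space_of j)"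
  shows "uniformly_bounded_below (\<lambda>n. associated_graph (an n) j)"
proof -
  obtain k where k: "\<And>n u. u \<in> form_space j (an n) \<Longrightarrow> 0 \<le> Re (an n u u) + real k * (norm (j u))\<^sup>2"
    using forms_uniformly_bounded_below[OF assms(1,2,6,7,8,3,9,10,11)] by blast
  have "cinner x y \<in> \<real> \<and> 0 \<le> Re (cinner x y) + real k * (norm x)\<^sup>2"
    if xy: "(x, y) \<in> associated_graph (an n) j" for n x y
  proof -
    obtain u where ju: "j u = x" and u: "\<And>v. an n u v = cinner y (j v)"
      using xy unfolding associated_graph_def by blast
    have "u \<in> form_space j (an n)" by (simp add: form_space_def null_space_of_def u)
    then have low: "0 \<le> Re (an n u u) + real k * (norm x)\<^sup>2" using k ju by blast
    have sym: "cnj (an n u u) = an n u u" using assms(7)[of n] unfolding symmetric_form_def by metis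
    then have "cinner x y = an n u u" using cinner_commute[of x y] u[of u] ju by simp
    with low sym show ?thesis by (simp add: Reals_cnj_iff)
  qed
  then show ?thesis unfolding uniformly_bounded_below_def by blast
qed

end
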